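(* There exists $\varepsilon>0$ such that for every positive integer $k$, $\operatorname{sat}(k)\le 2^{(1-\varepsilon)k}$.
   Context: For a set $X$, a collection $\mathcal{F}\subseteq\mathcal{P}(X)$ is a $k$-Sperner system if it contains no $(k+1)$-chain, i.e. no sets $A_1\subsetneq A_2\subsetneq\dots\subsetneq A_{k+1}$ all in $\mathcal{F}$. It is a saturated $k$-Sperner system if it is a $k$-Sperner system and for every $S\in\mathcal{P}(X)\setminus\mathcal{F}$ the collection $\mathcal{F}\cup\{S\}$ contains a $(k+1)$-chain. $\operatorname{sat}(n,k)$ denotes the minimum size of a saturated $k$-Sperner system in $\mathcal{P}(X)$ with $|X|=n$. For fixed $k$, $\operatorname{sat}(n,k)$ is constant for all sufficiently large $n$, and $\operatorname{sat}(k):=\lim_{n\to\infty}\operatorname{sat}(n,k)$. *)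

theory Defs
  imports Complex_Main
begin

definition has_chain :: "nat \<Rightarrow> 'a set set \<Rightarrow> bool" where
  "has_chain m \<F> \<longleftrightarrow>
     (\<exists>As. length As = m \<and> set As \<subseteq> \<F> \<and> sorted_wrt (\<subset>) As)"

definition sperner_system :: "nat \<Rightarrow> 'a set \<Rightarrow> 'a set set \<Rightarrow> bool" where
  "sperner_system k X \<F> \<longleftrightarrow> \<F> \<subseteq> Pow X \<and> \<not> has_chain (k + 1) \<F>"

definition saturated_sperner_system :: "nat \<Rightarrow> 'a set \<Rightarrow> 'a set set \<Rightarrow> bool" where
  "saturated_sperner_system k X \<F> \<longleftrightarrow>
     sperner_system k X \<F> \<and> (\<forall>S \<in> Pow X - \<F>. has_chain (k + 1) (\<F> \<union> {S}))"

definition sat :: "nat \<Rightarrow> nat \<Rightarrow> nat" where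
  "sat n k = Min {card \<F> |\<F>. saturated_sperner_system k {1..n} \<F>}"

text \<open>The set whose minimum is taken is finite and nonempty, so \<^const>\<open>sat\<close> is well defined.\<close>

lemma finite_saturated_sperner_systems:
  assumes "finite X"
  shows "finite {\<F>. saturated_sperner_system k X \<F>}"
  by (rule finite_subset[of _ "Pow (Pow X)"])
     (auto simp: assms saturated_sperner_system_def sperner_system_def)

lemma ex_saturated_sperner_system:
  assumes "finite X"
  shows "\<exists>\<F>. saturated_sperner_system k X \<F>"
proof -
  have fin: "finite {\<F>. sperner_system k X \<F>}"
    by (rule finite_subset[of _ "Pow (Pow X)"]) (auto simp: assms sperner_system_def)
  have "{} \<in> {\<F>. sperner_system k X \<F>}"
    by (auto simp: sperner_system_def has_chain_def)
  then obtain \<F> where F: "sperner_system k X \<F>"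
    and max: "\<And>\<G>. sperner_system k X \<G> \<Longrightarrow> \<F> \<subseteq> \<G> \<Longrightarrow> \<F> = \<G>"
    using finite_has_maximal[OF fin] by blast
  have "has_chain (k + 1) (\<F> \<union> {S})" if "S \<in> Pow X - \<F>" for S
    using max[of "\<F> \<union> {S}"] F that by (auto simp: sperner_system_def)
  with F show ?thesis
    by (auto simp: saturated_sperner_system_def)
qed

definition sat_lim :: "nat \<Rightarrow> real" where
  "sat_lim k = lim (\<lambda>n. real (sat n k))"

end

theory Submission
  imports Defs
begin

text \<open>
  Let \<open>g\<close> be a monotone function from the subsets of \<open>Y\<close> to \<open>{0..m}\<close> such that every set of positive
  rank contains a set of rank one less, and every set of rank below \<open>m\<close> lies in a set of rank one more.
  For a nonempty \<open>H\<close> disjoint from \<open>Y\<close>, the minimal sets of each level of \<open>g\<close> together with the maximal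
  sets of each level, the latter enlarged by \<open>H\<close>, form a saturated \<open>(m + 2)\<close>-Sperner system on
  \<open>Y \<union> H\<close>: below any \<open>S\<close> there is a chain of \<open>g (S \<inter> Y) + 1\<close> small members, and above it one of
  \<open>m - g (S \<inter> Y) + 1\<close> large members. Adding the ranks of two disjoint ground sets adds the values of
  \<open>m\<close> and multiplies the numbers of minimal and of maximal sets. Cardinality on four points has \<open>m = 4\<close>
  and 16 minimal sets; a rank on six points with \<open>m = 4\<close> and only 15 minimal and 15 maximal sets
  therefore gives the exponential saving. The limit in \<open>n\<close> exists because, once \<open>n\<close> is large compared
  to the system, two points belong to the same members and one of them can be cloned.
\<close>

section \<open>Chains\<close>

text \<open>Strictly increasing ranks along a chain of \<open>k + 1\<close> members would be
  \<open>k + 1\<close> distinct numbers below \<open>k\<close>.\<close>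

lemma no_has_chain_strict_rank:
  fixes \<phi> :: "'a set \<Rightarrow> nat"
  assumes mono: "\<And>A B. A \<in> \<F> \<Longrightarrow> B \<in> \<F> \<Longrightarrow> A \<subset> B \<Longrightarrow> \<phi> A < \<phi> B"
    and bound: "\<And>A. A \<in> \<F> \<Longrightarrow> \<phi> A < k"
  shows "\<not> has_chain (k + 1) \<F>"
proof
  assume "has_chain (k + 1) \<F>"
  then obtain As where As: "length As = k + 1" "set As \<subseteq> \<F>" "sorted_wrt (\<subset>) As"
    unfolding has_chain_def by blast
  have "sorted_wrt (\<lambda>A B. \<phi> A < \<phi> B) As"
    using As by (intro sorted_wrt_mono_rel[OF _ As(3)]) (auto intro: mono)
  then have "distinct (map \<phi> As)"
    using strict_sorted_iff[of "map \<phi> As"] by (simp add: sorted_wrt_map)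
  then have "card (set (map \<phi> As)) = k + 1"
    using As(1) distinct_card by fastforce
  moreover have "set (map \<phi> As) \<subseteq> {..<k}"
    using As(2) bound by auto
  ultimately show False
    using card_mono[of "{..<k}" "set (map \<phi> As)"] by simp
qed

lemma has_chain_through:
  assumes "set As \<subseteq> \<F>" "set Bs \<subseteq> \<F>" "sorted_wrt (\<subset>) As" "sorted_wrt (\<subset>) Bs"
    and "\<And>A. A \<in> set As \<Longrightarrow> A \<subset> S" "\<And>B. B \<in> set Bs \<Longrightarrow> S \<subset> B"
    and "length As + length Bs = k"
  shows "has_chain (k + 1) (\<F> \<union> {S})"
  unfolding has_chain_def
proof (intro exI conjI)
  have "A \<subset> B" if "A \<in> set As" "B \<in> set Bs" for A B
    using assms(5)[OF that(1)] assms(6)[OF that(2)] by (rule psubset_trans)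
  then show "sorted_wrt (\<subset>) (As @ S # Bs)"
    using assms by (simp add: sorted_wrt_append)
qed (use assms in auto)

text \<open>The family alone has no such chain, so the chain passes through \<open>S\<close> and
  splits there into a part below and a part above. This is the converse of
  \<open>has_chain_through\<close>.\<close>

lemma has_chain_throughE:
  assumes "has_chain (k + 1) (\<F> \<union> {S})" "\<not> has_chain (k + 1) \<F>"
  obtains As Bs where "set As \<subseteq> \<F>" "set Bs \<subseteq> \<F>" "sorted_wrt (\<subset>) As" "sorted_wrt (\<subset>) Bs"
    and "\<And>A. A \<in> set As \<Longrightarrow> A \<subset> S" "\<And>B. B \<in> set Bs \<Longrightarrow> S \<subset> B"
    and "length As + length Bs = k"
proof -
  obtain Cs where Cs: "length Cs = k + 1" "set Cs \<subseteq> \<F> \<union> {S}" "sorted_wrt (\<subset>) Cs"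
    using assms(1) unfolding has_chain_def by blast
  then have "S \<in> set Cs"
    using assms(2) unfolding has_chain_def by blast
  then obtain As Bs where split: "Cs = As @ S # Bs"
    by (auto simp: in_set_conv_decomp)
  show thesis
    by (rule that[of As Bs]) (use Cs in \<open>auto simp: split sorted_wrt_append\<close>)
qed

text \<open>Covers \<open>k = 1\<close>; the construction from rank functions only yields
  \<open>k\<close> of the form \<open>m + 2\<close>.\<close>

lemma saturated_sperner_system_bot: "saturated_sperner_system 1 X {{}}"
proof -
  have "\<not> has_chain (1 + 1) {{} :: 'a set}"
    by (rule no_has_chain_strict_rank[where \<phi> = "\<lambda>_. 0"]) auto
  moreover have "has_chain (1 + 1) ({{}} \<union> {S})" if "S \<noteq> {}" for S :: "'a set"
    by (rule has_chain_through[where As = "[{}]" and Bs = "[]"]) (use that in auto)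
  ultimately show ?thesis
    by (auto simp: saturated_sperner_system_def sperner_system_def)
qed

section \<open>Cloning a point and the limit\<close>

text \<open>The map \<open>c\<close> makes \<open>z\<close> a copy of \<open>x\<close> and is undone
  on members by deleting \<open>z\<close>, so it preserves and reflects strict inclusion. For
  saturation, a new set \<open>S\<close> is replaced by a nonmember \<open>T\<close> of the old
  ground set, and the chain through \<open>T\<close> is carried over to \<open>S\<close>. The second
  point \<open>y\<close> serves the sets \<open>S\<close> that separate \<open>x\<close> from
  \<open>z\<close>.\<close>

lemma saturated_sperner_system_clone:
  assumes sat: "saturated_sperner_system k X \<F>"
    and xy: "x \<in> X" "y \<in> X" "x \<noteq> y" "\<And>A. A \<in> \<F> \<Longrightarrow> x \<in> A \<longleftrightarrow> y \<in> A"
    and z: "z \<notin> X"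
  defines "c \<equiv> \<lambda>A. if x \<in> A then insert z A else A"
  shows "saturated_sperner_system k (insert z X) (c ` \<F>)"
proof -
  have sub: "\<F> \<subseteq> Pow X" and no: "\<not> has_chain (k + 1) \<F>"
    and chain: "\<And>S. S \<subseteq> X \<Longrightarrow> S \<notin> \<F> \<Longrightarrow> has_chain (k + 1) (\<F> \<union> {S})"
    using sat by (auto simp: saturated_sperner_system_def sperner_system_def)
  have c_mono: "c A \<subset> c B" if "A \<subset> B" "B \<subseteq> X" for A B
    using that z by (auto simp: c_def)
  have c_inv: "c A - {z} = A" if "A \<in> \<F>" for A
    using that sub z by (auto simp: c_def)
  have c_refl: "A \<subset> B" if "c A \<subset> c B" "A \<in> \<F>" "B \<in> \<F>" for A B
    using that c_inv[of A] c_inv[of B] by (metis Diff_mono order_refl psubset_eq)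
  have "\<not> has_chain (k + 1) (c ` \<F>)"
  proof
    assume "has_chain (k + 1) (c ` \<F>)"
    then obtain As where As: "length As = k + 1" "set As \<subseteq> c ` \<F>" "sorted_wrt (\<subset>) As"
      unfolding has_chain_def by blast
    have "sorted_wrt (\<lambda>A B. A - {z} \<subset> B - {z}) As"
    proof (rule sorted_wrt_mono_rel[OF _ As(3)])
      fix A B assume "A \<in> set As" "B \<in> set As" and AB: "A \<subset> B"
      then obtain A' B' where "A' \<in> \<F>" "B' \<in> \<F>" "A = c A'" "B = c B'"
        using As(2) by blast
      with AB show "A - {z} \<subset> B - {z}"
        using c_refl c_inv by metis
    qed
    then have "sorted_wrt (\<subset>) (map (\<lambda>A. A - {z}) As)"
      by (simp add: sorted_wrt_map)
    moreover have "set (map (\<lambda>A. A - {z}) As) \<subseteq> \<F>"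
      using As(2) c_inv by auto
    moreover have "length (map (\<lambda>A. A - {z}) As) = k + 1"
      using As(1) by simp
    ultimately show False
      using no unfolding has_chain_def by blast
  qed
  moreover have "has_chain (k + 1) (c ` \<F> \<union> {S})" if S: "S \<subseteq> insert z X" "S \<notin> c ` \<F>" for S
  proof -
    have sorted_c: "sorted_wrt (\<subset>) (map c As)" if "sorted_wrt (\<subset>) As" "set As \<subseteq> \<F>" for As
    proof -
      have "sorted_wrt (\<lambda>A B. c A \<subset> c B) As"
        using that sub by (intro sorted_wrt_mono_rel[OF _ that(1)] c_mono) auto
      then show ?thesis
        by (simp add: sorted_wrt_map)
    qed
    \<comment> \<open>If \<open>S\<close> treats \<open>x\<close> and \<open>z\<close> alike, then
      \<open>S = c T\<close>. Otherwise \<open>T\<close> is made to separate \<open>x\<close> from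
      \<open>y\<close>, which no member of the family does.\<close>
    define T where "T = (if x \<in> S \<longleftrightarrow> z \<in> S then S - {z} else insert x (S - {x, y, z}))"
    have "T \<subseteq> X"
      using S(1) xy(1) by (auto simp: T_def)
    moreover have "T \<notin> \<F>"
    proof (cases "x \<in> S \<longleftrightarrow> z \<in> S")
      case True
      then have "c T = S"
        using xy(1) z by (auto simp: T_def c_def)
      then show ?thesis
        using S(2) by blast
    next
      case False
      then have "x \<in> T" "y \<notin> T"
        using xy(3) by (auto simp: T_def)
      then show ?thesis
        using xy(4) by blast
    qed
    ultimately obtain As Bs where AB: "set As \<subseteq> \<F>" "set Bs \<subseteq> \<F>"
        "sorted_wrt (\<subset>) As" "sorted_wrt (\<subset>) Bs"
        and below: "\<And>A. A \<in> set As \<Longrightarrow> A \<subset> T" and above: "\<And>B. B \<in> set Bs \<Longrightarrow> T \<subset> B"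
        and len: "length As + length Bs = k"
      using has_chain_throughE[OF chain no] by metis
    have below': "c A \<subset> S" if "A \<in> set As" for A
    proof (cases "x \<in> S \<longleftrightarrow> z \<in> S")
      case True
      then have "c T = S"
        using xy(1) z by (auto simp: T_def c_def)
      then show ?thesis
        using c_mono[OF below[OF that] \<open>T \<subseteq> X\<close>] by simp
    next
      case False
      then have T: "T = insert x (S - {x, y, z})"
        by (simp add: T_def)
      then have "x \<notin> A"
        using below[OF that] xy(3,4) AB(1) that by blast
      then have "c A = A" "A \<subseteq> S - {x, y, z}"
        using below[OF that] T by (auto simp: c_def)
      \<comment> \<open>\<open>S\<close> contains exactly one of \<open>x\<close> and
        \<open>z\<close>, while \<open>c A\<close> contains neither, so the inclusion is
        strict.\<close>
      then show ?thesis
        using False by auto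
    qed
    have above': "S \<subset> c B" if "B \<in> set Bs" for B
    proof (cases "x \<in> S \<longleftrightarrow> z \<in> S")
      case True
      then have "c T = S"
        using xy(1) z by (auto simp: T_def c_def)
      moreover have "B \<subseteq> X"
        using that AB(2) sub by auto
      ultimately show ?thesis
        using c_mono[OF above[OF that]] by simp
    next
      case False
      then have T: "T = insert x (S - {x, y, z})"
        by (simp add: T_def)
      then have "x \<in> B" "y \<in> B"
        using above[OF that] xy(4) AB(2) that by blast+
      then have "c B = insert z B" "S \<subseteq> insert z B"
        using above[OF that] T by (auto simp: c_def)
      \<comment> \<open>Here \<open>c B\<close> contains both \<open>x\<close> and \<open>z\<close>,
        and \<open>S\<close> only one of them.\<close>
      then show ?thesis
        using False \<open>x \<in> B\<close> by auto
    qed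
    show ?thesis
    proof (rule has_chain_through)
      show "sorted_wrt (\<subset>) (map c As)" "sorted_wrt (\<subset>) (map c Bs)"
        using AB sorted_c by blast+
      show "A \<subset> S" if A: "A \<in> set (map c As)" for A
      proof -
        obtain C where "C \<in> set As" "A = c C"
          using A by auto
        then show ?thesis
          using below' by simp
      qed
      show "S \<subset> B" if B: "B \<in> set (map c Bs)" for B
      proof -
        obtain C where "C \<in> set Bs" "B = c C"
          using B by auto
        then show ?thesis
          using above' by simp
      qed
    qed (use AB len in auto)
  qed
  moreover have "c ` \<F> \<subseteq> Pow (insert z X)"
    using sub by (auto simp: c_def)
  ultimately show ?thesis
    by (auto simp: saturated_sperner_system_def sperner_system_def)
qed

text \<open>Pigeonhole: each point determines the subfamily of members containing it, and there are
  at most \<open>2 ^ card \<F>\<close> subfamilies.\<close>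

lemma ex_homogeneous_pair:
  assumes "finite X" "finite \<F>" "2 ^ card \<F> < card X"
  obtains x y where "x \<in> X" "y \<in> X" "x \<noteq> y" "\<And>A. A \<in> \<F> \<Longrightarrow> x \<in> A \<longleftrightarrow> y \<in> A"
proof -
  let ?f = "\<lambda>x. {A \<in> \<F>. x \<in> A}"
  have "?f ` X \<subseteq> Pow \<F>"
    by auto
  then have "card (?f ` X) \<le> 2 ^ card \<F>"
    using card_mono[of "Pow \<F>"] assms(2) by (simp add: card_Pow)
  then have "\<not> inj_on ?f X"
    using assms(3) card_image by fastforce
  then show thesis
    using that unfolding inj_on_def by blast
qed

section \<open>Eventual monotonicity of \<open>sat\<close> in \<open>n\<close> and its limit\<close>

lemma sat_le_card:
  assumes "saturated_sperner_system k {1..n} \<F>"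
  shows "sat n k \<le> card \<F>"
  unfolding sat_def
  by (rule Min_le) (use assms finite_saturated_sperner_systems[of "{1..n}" k] in auto)

lemma sat_attained:
  obtains \<F> where "saturated_sperner_system k {1..n} \<F>" "card \<F> = sat n k"
proof -
  have "sat n k \<in> {card \<F> |\<F>. saturated_sperner_system k {1..n} \<F>}"
    unfolding sat_def
    by (rule Min_in)
      (use finite_saturated_sperner_systems[of "{1..n}" k] ex_saturated_sperner_system[of "{1..n}" k]
        in auto)
  then show thesis
    using that by auto
qed

text \<open>A minimum system on \<open>n\<close> points has a homogeneous pair; cloning one of its
  points gives a system on \<open>n + 1\<close> points with no more members.\<close>

lemma sat_Suc_le:
  assumes "2 ^ sat n k < n"
  shows "sat (Suc n) k \<le> sat n k"
proof -
  obtain \<F> where F: "saturated_sperner_system k {1..n} \<F>" "card \<F> = sat n k"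
    by (rule sat_attained)
  then have "\<F> \<subseteq> Pow {1..n}"
    by (simp add: saturated_sperner_system_def sperner_system_def)
  then have fin: "finite \<F>"
    by (rule finite_subset) simp
  then obtain x y where xy: "x \<in> {1..n}" "y \<in> {1..n}" "x \<noteq> y" "\<And>A. A \<in> \<F> \<Longrightarrow> x \<in> A \<longleftrightarrow> y \<in> A"
    using ex_homogeneous_pair[of "{1..n}" \<F>] F(2) assms by auto
  have "sat (Suc n) k \<le> card ((\<lambda>A. if x \<in> A then insert (Suc n) A else A) ` \<F>)"
    using saturated_sperner_system_clone[OF F(1) xy, of "Suc n"]
    by (intro sat_le_card) (simp add: atLeastAtMostSuc_conv)
  also have "\<dots> \<le> card \<F>"
    by (rule card_image_le[OF fin])
  finally show ?thesis
    using F(2) by simp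
qed

text \<open>A bound for large \<open>n\<close> also forces convergence: \<open>2 ^ sat n k\<close>
  stays bounded, so from some \<open>n\<close> on cloning applies and the sequence is
  nonincreasing.\<close>

lemma sat_lim_le:
  assumes bound: "\<And>n. n \<ge> N \<Longrightarrow> sat n k \<le> s"
  shows "sat_lim k \<le> real s"
proof -
  define M where "M = max N (Suc (2 ^ s))"
  have "sat (Suc n) k \<le> sat n k" if "n \<ge> M" for n
  proof -
    have "(2::nat) ^ sat n k \<le> 2 ^ s"
      using bound[of n] that by (intro power_increasing) (simp_all add: M_def)
    also have "\<dots> < n"
      using that by (simp add: M_def)
    finally show ?thesis
      by (rule sat_Suc_le)
  qed
  then have "decseq (\<lambda>n. real (sat (n + M) k))"
    by (intro decseq_SucI) simp
  then obtain L where "(\<lambda>n. real (sat (n + M) k)) \<longlonglongrightarrow> L"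
    using decseq_convergent[of _ 0] by (metis of_nat_0_le_iff)
  then have L: "(\<lambda>n. real (sat n k)) \<longlonglongrightarrow> L"
    by (rule LIMSEQ_offset)
  then have "L \<le> real s"
    by (rule LIMSEQ_le_const2) (use bound in auto)
  then show ?thesis
    using limI[OF L] by (simp add: sat_lim_def)
qed

section \<open>Gradual rank functions\<close>

text \<open>The steps concern some subset or superset, not single points: one added point may raise
  the rank by more than one. In the six-point example below, the rank jumps from 0 on
  \<open>{b,e}\<close> to 3 on \<open>{b,d,e}\<close>.\<close>

locale gradual_rank =
  fixes Y :: "'a set" and m :: nat and g :: "'a set \<Rightarrow> nat"
  assumes finite_ground: "finite Y"
    and rank_mono: "S \<subseteq> T \<Longrightarrow> T \<subseteq> Y \<Longrightarrow> g S \<le> g T"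
    and rank_le: "S \<subseteq> Y \<Longrightarrow> g S \<le> m"
    and step_down: "S \<subseteq> Y \<Longrightarrow> 0 < g S \<Longrightarrow> \<exists>T. T \<subset> S \<and> g S = Suc (g T)"
    and step_up: "S \<subseteq> Y \<Longrightarrow> g S < m \<Longrightarrow> \<exists>T. S \<subset> T \<and> T \<subseteq> Y \<and> g T = Suc (g S)"

section \<open>Minimal and maximal sets of the levels\<close>

definition level_mins :: "'a set \<Rightarrow> ('a set \<Rightarrow> nat) \<Rightarrow> 'a set set" where
  "level_mins Y g = {A. A \<subseteq> Y \<and> (\<forall>S. S \<subset> A \<longrightarrow> g S \<noteq> g A)}"

definition level_maxs :: "'a set \<Rightarrow> ('a set \<Rightarrow> nat) \<Rightarrow> 'a set set" where
  "level_maxs Y g = {B. B \<subseteq> Y \<and> (\<forall>S. B \<subset> S \<and> S \<subseteq> Y \<longrightarrow> g S \<noteq> g B)}"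

lemma level_mins_subset_Pow: "level_mins Y g \<subseteq> Pow Y"
  by (auto simp: level_mins_def)

lemma level_maxs_subset_Pow: "level_maxs Y g \<subseteq> Pow Y"
  by (auto simp: level_maxs_def)

context gradual_rank
begin

lemma rank_less_level_mins: "S \<subset> A \<Longrightarrow> A \<in> level_mins Y g \<Longrightarrow> g S < g A"
  using rank_mono[of S A] by (simp add: level_mins_def order.strict_iff_order)

lemma rank_less_level_maxs: "B \<in> level_maxs Y g \<Longrightarrow> B \<subset> S \<Longrightarrow> S \<subseteq> Y \<Longrightarrow> g B < g S"
  using rank_mono[of B S] by (simp add: level_maxs_def order.strict_iff_order) metis

lemma ex_level_min:
  assumes "S \<subseteq> Y"
  obtains A where "A \<in> level_mins Y g" "A \<subseteq> S" "g A = g S"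
proof -
  have "finite {A. A \<subseteq> S \<and> g A = g S}"
    by (rule finite_subset[of _ "Pow Y"]) (use assms finite_ground in auto)
  from finite_has_minimal2[OF this, of S] obtain A where
    A: "A \<subseteq> S" "g A = g S" "\<forall>B. B \<subseteq> S \<and> g B = g S \<longrightarrow> B \<subseteq> A \<longrightarrow> A = B"
    by auto
  have "g T \<noteq> g A" if "T \<subset> A" for T
    using A(1,2) A(3)[rule_format, of T] that by auto
  then have "A \<in> level_mins Y g"
    using A(1) assms by (simp add: level_mins_def)
  then show thesis
    using that A(1,2) by simp
qed

lemma ex_level_max:
  assumes "S \<subseteq> Y"
  obtains B where "B \<in> level_maxs Y g" "S \<subseteq> B" "g B = g S"
proof -
  have "finite {B. S \<subseteq> B \<and> B \<subseteq> Y \<and> g B = g S}"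
    by (rule finite_subset[of _ "Pow Y"]) (use finite_ground in auto)
  from finite_has_maximal2[OF this, of S] obtain B where
    B: "S \<subseteq> B" "B \<subseteq> Y" "g B = g S" "\<forall>T. S \<subseteq> T \<and> T \<subseteq> Y \<and> g T = g S \<longrightarrow> B \<subseteq> T \<longrightarrow> B = T"
    using assms by auto
  have "g T \<noteq> g B" if "B \<subset> T" "T \<subseteq> Y" for T
    using B(1,3) B(4)[rule_format, of T] that by auto
  then have "B \<in> level_maxs Y g"
    using B(2) by (simp add: level_maxs_def)
  then show thesis
    using that B(1,3) by simp
qed

text \<open>Shrink \<open>S\<close> to a minimal set \<open>A\<close> of its level, step down from
  \<open>A\<close> to rank one less, and recurse; each rank from 0 to \<open>g S\<close> contributes
  one set.\<close>

lemma level_mins_chain: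
  assumes "S \<subseteq> Y"
  shows "\<exists>As. length As = Suc (g S) \<and> set As \<subseteq> level_mins Y g \<and> sorted_wrt (\<subset>) As \<and>
    (\<forall>A\<in>set As. A \<subseteq> S)"
  using assms
proof (induction "g S" arbitrary: S)
  case 0
  obtain A where "A \<in> level_mins Y g" "A \<subseteq> S"
    using ex_level_min[OF 0(2)] .
  then show ?case
    using 0(1) by (intro exI[of _ "[A]"]) auto
next
  case (Suc i)
  obtain A where A: "A \<in> level_mins Y g" "A \<subseteq> S" "g A = g S"
    using ex_level_min[OF Suc(3)] .
  obtain T where T: "T \<subset> A" "g A = Suc (g T)"
    using step_down[of A] A Suc(2,3) by auto
  have "T \<subseteq> Y" "i = g T"
    using T A Suc(2,3) by auto
  then obtain As where As: "length As = Suc (g T)" "set As \<subseteq> level_mins Y g"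
    "sorted_wrt (\<subset>) As" "\<forall>A\<in>set As. A \<subseteq> T"
    using Suc(1)[of T] by auto
  have below: "C \<subset> A" if "C \<in> set As" for C
    using that As(4) T(1) by blast
  show ?case
  proof (intro exI conjI)
    show "sorted_wrt (\<subset>) (As @ [A])"
      using As(3) below by (simp add: sorted_wrt_append)
    show "\<forall>C\<in>set (As @ [A]). C \<subseteq> S"
      using below A(2) by auto
  qed (use A T As in auto)
qed

text \<open>The dual argument, by induction on the remaining distance \<open>m - g S\<close> to the
  top rank.\<close>

lemma level_maxs_chain:
  assumes "S \<subseteq> Y"
  shows "\<exists>Bs. length Bs = Suc (m - g S) \<and> set Bs \<subseteq> level_maxs Y g \<and> sorted_wrt (\<subset>) Bs \<and>
    (\<forall>B\<in>set Bs. S \<subseteq> B)"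
  using assms
proof (induction "m - g S" arbitrary: S)
  case 0
  obtain B where "B \<in> level_maxs Y g" "S \<subseteq> B"
    using ex_level_max[OF 0(2)] .
  then show ?case
    using 0(1) by (intro exI[of _ "[B]"]) auto
next
  case (Suc i)
  obtain B where B: "B \<in> level_maxs Y g" "S \<subseteq> B" "g B = g S"
    using ex_level_max[OF Suc(3)] .
  have "B \<subseteq> Y" "g B < m"
    using B Suc(2) level_maxs_subset_Pow[of Y g] by auto
  then obtain T where T: "B \<subset> T" "T \<subseteq> Y" "g T = Suc (g B)"
    using step_up[of B] by auto
  have "i = m - g T"
    using B T Suc(2) by simp
  then obtain Bs where Bs: "length Bs = Suc (m - g T)" "set Bs \<subseteq> level_maxs Y g"
    "sorted_wrt (\<subset>) Bs" "\<forall>B\<in>set Bs. T \<subseteq> B"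
    using Suc(1)[of T] T(2) by auto
  have above: "B \<subset> C" if "C \<in> set Bs" for C
    using that Bs(4) T(1) by blast
  show ?case
  proof (intro exI conjI)
    show "sorted_wrt (\<subset>) (B # Bs)"
      using Bs(3) above by simp
    show "\<forall>C\<in>set (B # Bs). S \<subseteq> C"
      using above B(2) by auto
  qed (use B T Bs \<open>g B < m\<close> in auto)
qed

lemma saturated_sperner_system_levels:
  assumes H: "H \<inter> Y = {}" "H \<noteq> {}"
  shows "saturated_sperner_system (m + 2) (Y \<union> H) (level_mins Y g \<union> (\<lambda>B. B \<union> H) ` level_maxs Y g)"
    (is "saturated_sperner_system _ _ ?F")
proof -
  have sub: "?F \<subseteq> Pow (Y \<union> H)"
    using level_mins_subset_Pow[of Y g] level_maxs_subset_Pow[of Y g] by auto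
  \<comment> \<open>The extra unit for containing \<open>H\<close> makes the passage from a small to
    a large member strict even at equal rank. The values are at most \<open>m + 1\<close>, so chains
    have at most \<open>m + 2\<close> members.\<close>
  define \<phi> where "\<phi> A = g (A \<inter> Y) + of_bool (H \<subseteq> A)" for A
  have small: "A \<subseteq> Y" "A \<inter> Y = A" "\<not> H \<subseteq> A" "\<phi> A = g A" if "A \<in> level_mins Y g" for A
    using that H level_mins_subset_Pow[of Y g] by (auto simp: \<phi>_def Int_absorb2)
  have large: "B \<subseteq> Y" "(B \<union> H) \<inter> Y = B" "\<phi> (B \<union> H) = Suc (g B)" if "B \<in> level_maxs Y g" for B
  proof -
    show "B \<subseteq> Y"
      using that level_maxs_subset_Pow[of Y g] by auto
    then show *: "(B \<union> H) \<inter> Y = B"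
      using H by auto
    show "\<phi> (B \<union> H) = Suc (g B)"
      by (simp add: \<phi>_def *)
  qed
  have "\<not> has_chain (m + 2 + 1) ?F"
  proof (rule no_has_chain_strict_rank)
    fix A assume "A \<in> ?F"
    then show "\<phi> A < m + 2"
      using small large rank_le by (auto simp: less_Suc_eq_le le_SucI)
  next
    fix A B assume AB: "A \<in> ?F" "B \<in> ?F" "A \<subset> B"
    consider "A \<in> level_mins Y g" "B \<in> level_mins Y g"
      | B' where "A \<in> level_mins Y g" "B = B' \<union> H" "B' \<in> level_maxs Y g"
      | A' B' where "A = A' \<union> H" "A' \<in> level_maxs Y g" "B = B' \<union> H" "B' \<in> level_maxs Y g"
      | A' where "A = A' \<union> H" "B \<in> level_mins Y g"
      using AB(1,2) by blast
    then show "\<phi> A < \<phi> B"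
    proof cases
      case 1
      then show ?thesis
        using AB(3) rank_less_level_mins small(4) by simp
    next
      case 2
      then have "A \<subseteq> B'"
        using AB(3) small(1)[of A] H by auto
      then show ?thesis
        using 2 rank_mono[of A B'] large(1,3)[of B'] small(4)[of A] by simp
    next
      case 3
      then have "A' \<subset> B'"
        using AB(3) large(2)[of A'] large(2)[of B'] by auto
      then show ?thesis
        using 3 rank_less_level_maxs[of A' B'] large(1)[of B'] by (simp add: large(3))
    next
      \<comment> \<open>Impossible: a large member contains \<open>H\<close>, and a small one does
        not because \<open>H\<close> is nonempty and disjoint from \<open>Y\<close>.\<close>
      case 4
      then show ?thesis
        using AB(3) small(3)[of B] by auto
    qed
  qed
  moreover have "has_chain (m + 2 + 1) (?F \<union> {S})" if S: "S \<subseteq> Y \<union> H" "S \<notin> ?F" for S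
  proof -
    have SY: "S \<inter> Y \<subseteq> Y"
      by simp
    obtain As where As: "length As = Suc (g (S \<inter> Y))" "set As \<subseteq> level_mins Y g"
      "sorted_wrt (\<subset>) As" "\<forall>A\<in>set As. A \<subseteq> S \<inter> Y"
      using level_mins_chain[OF SY] by blast
    obtain Bs where Bs: "length Bs = Suc (m - g (S \<inter> Y))" "set Bs \<subseteq> level_maxs Y g"
      "sorted_wrt (\<subset>) Bs" "\<forall>B\<in>set Bs. S \<inter> Y \<subseteq> B"
      using level_maxs_chain[OF SY] by blast
    have "sorted_wrt (\<lambda>A B. A \<union> H \<subset> B \<union> H) Bs"
    proof (rule sorted_wrt_mono_rel[OF _ Bs(3)])
      fix A B assume "A \<in> set Bs" "B \<in> set Bs" and AB: "A \<subset> B"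
      then show "A \<union> H \<subset> B \<union> H"
        using Bs(2) large(2)[of A] large(2)[of B] by blast
    qed
    then have "sorted_wrt (\<subset>) (map (\<lambda>B. B \<union> H) Bs)"
      by (simp add: sorted_wrt_map)
    \<comment> \<open>The inclusions around \<open>S\<close> are strict because \<open>S\<close> is
      not a member.\<close>
    moreover have "A \<subset> S" if "A \<in> set As" for A
      using that As(2,4) S(2) by blast
    moreover have "S \<subset> B \<union> H" if "B \<in> set Bs" for B
      using that Bs(2,4) S by blast
    moreover have "length As + length Bs = m + 2"
      using As(1) Bs(1) rank_le[OF SY] by simp
    ultimately show ?thesis
      using As(2,3) Bs(2)
      by (intro has_chain_through[where As = As and Bs = "map (\<lambda>B. B \<union> H) Bs"]) auto
  qed
  ultimately show ?thesis
    using sub by (auto simp: saturated_sperner_system_def sperner_system_def)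
qed

end

text \<open>The two traces of a set can be changed independently. A step up or down is made in one
  trace, leaving the other fixed. In a set minimal in its level both traces are minimal in theirs,
  since shrinking one at constant rank would shrink the whole set; the same holds for maximal
  sets.\<close>

lemma
  assumes "gradual_rank Y m g" "gradual_rank Y' m' g'" and disj: "Y \<inter> Y' = {}"
  defines "h \<equiv> \<lambda>S. g (S \<inter> Y) + g' (S \<inter> Y')"
  shows gradual_rank_add: "gradual_rank (Y \<union> Y') (m + m') h"
    and card_level_mins_add:
      "card (level_mins (Y \<union> Y') h) \<le> card (level_mins Y g) * card (level_mins Y' g')"
    and card_level_maxs_add:
      "card (level_maxs (Y \<union> Y') h) \<le> card (level_maxs Y g) * card (level_maxs Y' g')"
proof -
  interpret G: gradual_rank Y m g by fact
  interpret G': gradual_rank Y' m' g' by fact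
  have h: "h (A \<union> A') = g A + g' A'" if "A \<subseteq> Y" "A' \<subseteq> Y'" for A A'
  proof -
    have "(A \<union> A') \<inter> Y = A" "(A \<union> A') \<inter> Y' = A'"
      using that disj by auto
    then show ?thesis
      by (simp add: h_def)
  qed
  have split: "S = (S \<inter> Y) \<union> (S \<inter> Y')" if "S \<subseteq> Y \<union> Y'" for S
    using that by auto
  have h_eq: "h S = g (S \<inter> Y) + g' (S \<inter> Y')" for S
    by (simp add: h_def)
  show "gradual_rank (Y \<union> Y') (m + m') h"
  proof
    show "finite (Y \<union> Y')"
      using G.finite_ground G'.finite_ground by simp
    show "h S \<le> h T" if "S \<subseteq> T" "T \<subseteq> Y \<union> Y'" for S T
      unfolding h_eq using that by (intro add_mono G.rank_mono G'.rank_mono) auto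
    show "h S \<le> m + m'" if "S \<subseteq> Y \<union> Y'" for S
      unfolding h_eq using that by (intro add_mono G.rank_le G'.rank_le) auto
    show "\<exists>T. T \<subset> S \<and> h S = Suc (h T)" if S: "S \<subseteq> Y \<union> Y'" "0 < h S" for S
    proof (cases "0 < g (S \<inter> Y)")
      case True
      then obtain T where T: "T \<subset> S \<inter> Y" "g (S \<inter> Y) = Suc (g T)"
        using G.step_down[of "S \<inter> Y"] by auto
      then show ?thesis
        using disj h[of T "S \<inter> Y'"] by (intro exI[of _ "T \<union> (S \<inter> Y')"]) (auto simp: h_eq[of S])
    next
      case False
      then obtain T where T: "T \<subset> S \<inter> Y'" "g' (S \<inter> Y') = Suc (g' T)"
        using G'.step_down[of "S \<inter> Y'"] S by (auto simp: h_eq)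
      then show ?thesis
        using disj h[of "S \<inter> Y" T] by (intro exI[of _ "(S \<inter> Y) \<union> T"]) (auto simp: h_eq[of S])
    qed
    show "\<exists>T. S \<subset> T \<and> T \<subseteq> Y \<union> Y' \<and> h T = Suc (h S)" if S: "S \<subseteq> Y \<union> Y'" "h S < m + m'" for S
    proof (cases "g (S \<inter> Y) < m")
      case True
      then obtain T where T: "S \<inter> Y \<subset> T" "T \<subseteq> Y" "g T = Suc (g (S \<inter> Y))"
        using G.step_up[of "S \<inter> Y"] by auto
      then show ?thesis
        using S disj h[of T "S \<inter> Y'"] by (intro exI[of _ "T \<union> (S \<inter> Y')"]) (auto simp: h_eq[of S])
    next
      case False
      then obtain T where T: "S \<inter> Y' \<subset> T" "T \<subseteq> Y'" "g' T = Suc (g' (S \<inter> Y'))"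
        using G'.step_up[of "S \<inter> Y'"] S by (auto simp: h_eq)
      then show ?thesis
        using S disj h[of "S \<inter> Y" T] by (intro exI[of _ "(S \<inter> Y) \<union> T"]) (auto simp: h_eq[of S])
    qed
  qed
  have fin: "finite (level_mins Y g)" "finite (level_mins Y' g')"
    "finite (level_maxs Y g)" "finite (level_maxs Y' g')"
    using G.finite_ground G'.finite_ground
    by (auto intro: finite_subset[OF level_mins_subset_Pow] finite_subset[OF level_maxs_subset_Pow])
  have "level_mins (Y \<union> Y') h \<subseteq> (\<lambda>(A, A'). A \<union> A') ` (level_mins Y g \<times> level_mins Y' g')"
  proof
    fix S assume "S \<in> level_mins (Y \<union> Y') h"
    then have S: "S \<subseteq> Y \<union> Y'" "\<And>T. T \<subset> S \<Longrightarrow> h T \<noteq> h S"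
      by (auto simp: level_mins_def)
    have "g T \<noteq> g (S \<inter> Y)" if "T \<subset> S \<inter> Y" for T
    proof -
      have "T \<union> (S \<inter> Y') \<subset> S"
        using that disj by blast
      then show ?thesis
        using S(2)[of "T \<union> (S \<inter> Y')"] h[of T "S \<inter> Y'"] that h_eq[of S] by auto
    qed
    moreover have "g' T \<noteq> g' (S \<inter> Y')" if "T \<subset> S \<inter> Y'" for T
    proof -
      have "(S \<inter> Y) \<union> T \<subset> S"
        using that disj by blast
      then show ?thesis
        using S(2)[of "(S \<inter> Y) \<union> T"] h[of "S \<inter> Y" T] that h_eq[of S] by auto
    qed
    ultimately have "(S \<inter> Y, S \<inter> Y') \<in> level_mins Y g \<times> level_mins Y' g'"
      by (auto simp: level_mins_def)
    then show "S \<in> (\<lambda>(A, A'). A \<union> A') ` (level_mins Y g \<times> level_mins Y' g')"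
      by (rule rev_image_eqI) (simp add: split[OF S(1), symmetric])
  qed
  then show "card (level_mins (Y \<union> Y') h) \<le> card (level_mins Y g) * card (level_mins Y' g')"
    using fin by (metis card_cartesian_product finite_SigmaI surj_card_le)
  have "level_maxs (Y \<union> Y') h \<subseteq> (\<lambda>(A, A'). A \<union> A') ` (level_maxs Y g \<times> level_maxs Y' g')"
  proof
    fix S assume "S \<in> level_maxs (Y \<union> Y') h"
    then have S: "S \<subseteq> Y \<union> Y'" "\<And>T. S \<subset> T \<Longrightarrow> T \<subseteq> Y \<union> Y' \<Longrightarrow> h T \<noteq> h S"
      by (auto simp: level_maxs_def)
    have "g T \<noteq> g (S \<inter> Y)" if "S \<inter> Y \<subset> T" "T \<subseteq> Y" for T
    proof -
      have "S \<subset> T \<union> (S \<inter> Y')" "T \<union> (S \<inter> Y') \<subseteq> Y \<union> Y'"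
        using that S(1) disj by auto
      then show ?thesis
        using S(2)[of "T \<union> (S \<inter> Y')"] h[of T "S \<inter> Y'"] that h_eq[of S] by auto
    qed
    moreover have "g' T \<noteq> g' (S \<inter> Y')" if "S \<inter> Y' \<subset> T" "T \<subseteq> Y'" for T
    proof -
      have "S \<subset> (S \<inter> Y) \<union> T" "(S \<inter> Y) \<union> T \<subseteq> Y \<union> Y'"
        using that S(1) disj by auto
      then show ?thesis
        using S(2)[of "(S \<inter> Y) \<union> T"] h[of "S \<inter> Y" T] that h_eq[of S] by auto
    qed
    ultimately have "(S \<inter> Y, S \<inter> Y') \<in> level_maxs Y g \<times> level_maxs Y' g'"
      by (auto simp: level_maxs_def)
    then show "S \<in> (\<lambda>(A, A'). A \<union> A') ` (level_maxs Y g \<times> level_maxs Y' g')"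
      by (rule rev_image_eqI) (simp add: split[OF S(1), symmetric])
  qed
  then show "card (level_maxs (Y \<union> Y') h) \<le> card (level_maxs Y g) * card (level_maxs Y' g')"
    using fin by (metis card_cartesian_product finite_SigmaI surj_card_le)
qed

section \<open>A rank function on six points with small levels\<close>

text \<open>The points are parameters so that each induction step of \<open>ex_gradual_rank\<close>
  can use a fresh block.\<close>

locale six_points =
  fixes a b c d e f :: 'a
  assumes dist: "distinct [a, b, c, d, e, f]"
begin

text \<open>Candidates for the minimal sets of ranks 0 to 4, in numbers 1, 4, 5, 4, 1, hence 15 in
  total.\<close>

definition mins :: "nat \<Rightarrow> 'a set set" where
  "mins i = [{{}}, {{a}, {c}, {d}, {f}}, {{a,b}, {a,c}, {b,d}, {c,d}, {e,f}},
    {{b,d,e}, {a,c,e}, {b,d,f}, {a,c,f}}, {{a,c,d,f}}] ! i"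

text \<open>For \<open>i < 4\<close> these are the complements of the minimal transversals of
  \<open>mins (Suc i)\<close>, that is, the maximal sets containing no member of it. Their numbers
  are again 1, 4, 5, 4, 1.\<close>

definition maxs :: "nat \<Rightarrow> 'a set set" where
  "maxs i = [{{b,e}}, {{a,d,f}, {b,c,f}, {a,d,e}, {b,c,e}},
    {{c,d,e,f}, {b,c,e,f}, {a,d,e,f}, {a,b,e,f}, {a,b,c,d}},
    {{b,c,d,e,f}, {a,b,d,e,f}, {a,b,c,e,f}, {a,b,c,d,e}}, {{a,b,c,d,e,f}}] ! i"

text \<open>By \<open>mins_step\<close> the conditions are nested, so this is the largest
  \<open>i\<close> such that \<open>S\<close> contains a member of \<open>mins i\<close>. As a sum
  of monotone indicators it is visibly monotone.\<close>

definition rank :: "'a set \<Rightarrow> nat" where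
  "rank S = (\<Sum>i = 1..4. of_bool (\<exists>T\<in>mins i. T \<subseteq> S))"

lemmas mins_simps = mins_def[of 0, simplified] mins_def[of 1, simplified] mins_def[of 2, simplified]
  mins_def[of 3, simplified] mins_def[of 4, simplified]

lemmas maxs_simps = maxs_def[of 0, simplified] maxs_def[of 1, simplified] maxs_def[of 2, simplified]
  maxs_def[of 3, simplified] maxs_def[of 4, simplified]

lemma le_4_cases: "i \<le> 4 \<Longrightarrow> i = 0 \<or> i = 1 \<or> i = 2 \<or> i = 3 \<or> i = (4::nat)"
  by linarith

lemma rank_eq:
  "rank S = of_bool (\<exists>T\<in>mins 1. T \<subseteq> S) + of_bool (\<exists>T\<in>mins 2. T \<subseteq> S) +
    of_bool (\<exists>T\<in>mins 3. T \<subseteq> S) + of_bool (\<exists>T\<in>mins 4. T \<subseteq> S)"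
  by (simp add: rank_def numeral_eq_Suc)

lemma neqs: "a \<noteq> b" "a \<noteq> c" "a \<noteq> d" "a \<noteq> e" "a \<noteq> f" "b \<noteq> c" "b \<noteq> d" "b \<noteq> e" "b \<noteq> f"
  "c \<noteq> d" "c \<noteq> e" "c \<noteq> f" "d \<noteq> e" "d \<noteq> f" "e \<noteq> f"
  using dist by auto

lemma rank_mono: "S \<subseteq> T \<Longrightarrow> rank S \<le> rank T"
  unfolding rank_def by (intro sum_mono; simp only: of_bool_less_eq_iff; blast)

lemma rank_mins: "i \<le> 4 \<Longrightarrow> T \<in> mins i \<Longrightarrow> rank T = i"
proof -
  have "\<forall>T\<in>mins 0. rank T = 0" "\<forall>T\<in>mins 1. rank T = 1" "\<forall>T\<in>mins 2. rank T = 2"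
    "\<forall>T\<in>mins 3. rank T = 3" "\<forall>T\<in>mins 4. rank T = 4"
    unfolding One_nat_def mins_simps ball_simps
    by (simp_all add: rank_eq mins_simps neqs neqs[symmetric])
  then show "i \<le> 4 \<Longrightarrow> T \<in> mins i \<Longrightarrow> rank T = i"
    using le_4_cases by blast
qed

lemma rank_maxs: "i \<le> 4 \<Longrightarrow> T \<in> maxs i \<Longrightarrow> rank T = i"
proof -
  have "\<forall>T\<in>maxs 0. rank T = 0" "\<forall>T\<in>maxs 1. rank T = 1" "\<forall>T\<in>maxs 2. rank T = 2"
    "\<forall>T\<in>maxs 3. rank T = 3" "\<forall>T\<in>maxs 4. rank T = 4"
    unfolding One_nat_def maxs_simps ball_simps
    by (simp_all add: rank_eq mins_simps neqs neqs[symmetric])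
  then show "i \<le> 4 \<Longrightarrow> T \<in> maxs i \<Longrightarrow> rank T = i"
    using le_4_cases by blast
qed

lemma mins_step: "i < 4 \<Longrightarrow> T \<in> mins (Suc i) \<Longrightarrow> \<exists>T'\<in>mins i. T' \<subset> T"
proof -
  have "\<forall>T\<in>mins 1. \<exists>T'\<in>mins 0. T' \<subset> T" "\<forall>T\<in>mins 2. \<exists>T'\<in>mins 1. T' \<subset> T"
    "\<forall>T\<in>mins 3. \<exists>T'\<in>mins 2. T' \<subset> T" "\<forall>T\<in>mins 4. \<exists>T'\<in>mins 3. T' \<subset> T"
    unfolding One_nat_def mins_simps less_le_not_le by (simp_all add: neqs neqs[symmetric])
  moreover assume "i < 4" "T \<in> mins (Suc i)"
  ultimately show ?thesis
    using le_4_cases[of i] by (auto simp: numeral_eq_Suc)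
qed

lemma maxs_step: "i < 4 \<Longrightarrow> T \<in> maxs i \<Longrightarrow> \<exists>T'\<in>maxs (Suc i). T \<subset> T'"
proof -
  have "\<forall>T\<in>maxs 0. \<exists>T'\<in>maxs 1. T \<subset> T'" "\<forall>T\<in>maxs 1. \<exists>T'\<in>maxs 2. T \<subset> T'"
    "\<forall>T\<in>maxs 2. \<exists>T'\<in>maxs 3. T \<subset> T'" "\<forall>T\<in>maxs 3. \<exists>T'\<in>maxs 4. T \<subset> T'"
    unfolding One_nat_def maxs_simps less_le_not_le by (simp_all add: neqs neqs[symmetric])
  moreover assume "i < 4" "T \<in> maxs i"
  ultimately show ?thesis
    using le_4_cases[of i] by (auto simp: numeral_eq_Suc)
qed

text \<open>A set containing no member of \<open>mins (Suc i)\<close> misses a point of each, hence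
  misses a whole transversal and lies in its complement.\<close>

lemma mins_or_maxs:
  assumes S: "S \<subseteq> {a,b,c,d,e,f}" and "i < 4"
  shows "(\<exists>T\<in>mins (Suc i). T \<subseteq> S) \<or> (\<exists>B\<in>maxs i. S \<subseteq> B)"
proof -
  have "(\<exists>T\<in>mins 1. T \<subseteq> S) \<or> (\<exists>B\<in>maxs 0. S \<subseteq> B)"
  proof (cases "\<exists>T\<in>mins 1. T \<subseteq> S")
    case False
    then have "a \<notin> S" "c \<notin> S" "d \<notin> S" "f \<notin> S"
      by (simp_all add: mins_simps)
    then have "S \<subseteq> {b,e}"
      using S by blast
    then show ?thesis
      unfolding maxs_simps by blast
  qed simp
  moreover have "(\<exists>T\<in>mins 2. T \<subseteq> S) \<or> (\<exists>B\<in>maxs 1. S \<subseteq> B)"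
  proof (cases "\<exists>T\<in>mins 2. T \<subseteq> S")
    case False
    then have "\<not> (a \<in> S \<and> b \<in> S)" "\<not> (a \<in> S \<and> c \<in> S)" "\<not> (b \<in> S \<and> d \<in> S)"
      "\<not> (c \<in> S \<and> d \<in> S)" "\<not> (e \<in> S \<and> f \<in> S)"
      by (simp_all add: mins_simps)
    \<comment> \<open>The first four forbidden pairs are the edges of the 4-cycle \<open>a\<close>,
      \<open>b\<close>, \<open>d\<close>, \<open>c\<close>, so \<open>S\<close> misses one of its
      two diagonals; the fifth pair excludes \<open>e\<close> or \<open>f\<close>.\<close>
    then consider "b \<notin> S" "c \<notin> S" "e \<notin> S" | "b \<notin> S" "c \<notin> S" "f \<notin> S"
      | "a \<notin> S" "d \<notin> S" "e \<notin> S" | "a \<notin> S" "d \<notin> S" "f \<notin> S"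
      by argo
    then have "S \<subseteq> {a,d,f} \<or> S \<subseteq> {a,d,e} \<or> S \<subseteq> {b,c,f} \<or> S \<subseteq> {b,c,e}"
      by cases (use S in blast)+
    then show ?thesis
      unfolding One_nat_def maxs_simps by blast
  qed simp
  moreover have "(\<exists>T\<in>mins 3. T \<subseteq> S) \<or> (\<exists>B\<in>maxs 2. S \<subseteq> B)"
  proof (cases "\<exists>T\<in>mins 3. T \<subseteq> S")
    case False
    then have "\<not> (b \<in> S \<and> d \<in> S \<and> e \<in> S)" "\<not> (a \<in> S \<and> c \<in> S \<and> e \<in> S)"
      "\<not> (b \<in> S \<and> d \<in> S \<and> f \<in> S)" "\<not> (a \<in> S \<and> c \<in> S \<and> f \<in> S)"
      by (simp_all add: mins_simps)
    \<comment> \<open>If \<open>e\<close> or \<open>f\<close> is present, then \<open>S\<close>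
      misses a point of each of the pairs \<open>b\<close>, \<open>d\<close> and \<open>a\<close>,
      \<open>c\<close>.\<close>
    then consider "a \<notin> S" "b \<notin> S" | "a \<notin> S" "d \<notin> S" | "b \<notin> S" "c \<notin> S" | "c \<notin> S" "d \<notin> S"
      | "e \<notin> S" "f \<notin> S"
      by argo
    then have "S \<subseteq> {c,d,e,f} \<or> S \<subseteq> {b,c,e,f} \<or> S \<subseteq> {a,d,e,f} \<or> S \<subseteq> {a,b,e,f} \<or> S \<subseteq> {a,b,c,d}"
      by cases (use S in blast)+
    then show ?thesis
      unfolding One_nat_def maxs_simps by blast
  qed simp
  moreover have "(\<exists>T\<in>mins 4. T \<subseteq> S) \<or> (\<exists>B\<in>maxs 3. S \<subseteq> B)"
  proof (cases "\<exists>T\<in>mins 4. T \<subseteq> S")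
    case False
    then consider "a \<notin> S" | "c \<notin> S" | "d \<notin> S" | "f \<notin> S"
      by (auto simp: mins_simps)
    then have "S \<subseteq> {b,c,d,e,f} \<or> S \<subseteq> {a,b,d,e,f} \<or> S \<subseteq> {a,b,c,e,f} \<or> S \<subseteq> {a,b,c,d,e}"
      by cases (use S in blast)+
    then show ?thesis
      unfolding One_nat_def maxs_simps by blast
  qed simp
  ultimately show ?thesis
    using \<open>i < 4\<close> le_4_cases[of i] by (auto simp: numeral_eq_Suc)
qed

section \<open>Gradualness of the six-point rank and the counts of 15\<close>

lemma rank_le_4: "rank S \<le> 4"
  by (simp add: rank_eq of_bool_def)

text \<open>Otherwise \<open>S\<close> of rank \<open>Suc i\<close> would lie in a member of
  \<open>maxs i\<close>, which has rank only \<open>i\<close>.\<close>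

lemma ex_mins:
  assumes S: "S \<subseteq> {a,b,c,d,e,f}"
  shows "\<exists>T\<in>mins (rank S). T \<subseteq> S"
proof (cases "rank S")
  case 0
  then show ?thesis
    by (simp add: mins_simps)
next
  case (Suc i)
  then have i: "i < 4"
    using rank_le_4[of S] by simp
  have "\<not> S \<subseteq> B" if "B \<in> maxs i" for B
    using rank_maxs[of i B] rank_mono[of S B] that Suc i by auto
  then show ?thesis
    using mins_or_maxs[OF S i] Suc by auto
qed

text \<open>Otherwise \<open>S\<close> of rank below 4 would contain a member of the next list
  \<open>mins (Suc (rank S))\<close>, whose rank is larger.\<close>

lemma ex_maxs:
  assumes S: "S \<subseteq> {a,b,c,d,e,f}"
  shows "\<exists>B\<in>maxs (rank S). S \<subseteq> B"
proof (cases "rank S = 4")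
  case True
  then show ?thesis
    using S by (simp add: maxs_simps)
next
  case False
  then have i: "rank S < 4"
    using rank_le_4[of S] by simp
  have "\<not> T \<subseteq> S" if "T \<in> mins (Suc (rank S))" for T
    using rank_mins[of "Suc (rank S)" T] rank_mono[of T S] that i by auto
  then show ?thesis
    using mins_or_maxs[OF S i] by auto
qed

lemma maxs_subset: "i \<le> 4 \<Longrightarrow> B \<in> maxs i \<Longrightarrow> B \<subseteq> {a,b,c,d,e,f}"
  using le_4_cases[of i] by (auto simp: maxs_simps)

text \<open>Both steps pass through the lists: from \<open>S\<close> to a listed set of equal rank,
  then to a listed set of the adjacent rank.\<close>

lemma gradual_rank: "gradual_rank {a,b,c,d,e,f} 4 rank"
proof
  show "\<exists>T. T \<subset> S \<and> rank S = Suc (rank T)" if S: "S \<subseteq> {a,b,c,d,e,f}" "0 < rank S" for S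
  proof -
    obtain i where i: "rank S = Suc i" "i < 4"
      using S(2) rank_le_4[of S] by (cases "rank S") auto
    then obtain T where T: "T \<in> mins (Suc i)" "T \<subseteq> S"
      using ex_mins[OF S(1)] by auto
    then obtain T' where T': "T' \<in> mins i" "T' \<subset> T"
      using mins_step[of i T] i by auto
    then show ?thesis
      using T(2) i rank_mins[of i T'] by (intro exI[of _ T']) auto
  qed
  show "\<exists>T. S \<subset> T \<and> T \<subseteq> {a,b,c,d,e,f} \<and> rank T = Suc (rank S)"
    if S: "S \<subseteq> {a,b,c,d,e,f}" "rank S < 4" for S
  proof -
    obtain B where B: "B \<in> maxs (rank S)" "S \<subseteq> B"
      using ex_maxs[OF S(1)] by auto
    then obtain B' where B': "B' \<in> maxs (Suc (rank S))" "B \<subset> B'"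
      using maxs_step[OF S(2) B(1)] by auto
    then show ?thesis
      using B(2) S(2) rank_maxs[of "Suc (rank S)" B'] maxs_subset[of "Suc (rank S)" B']
      by (intro exI[of _ B']) auto
  qed
qed (use rank_mono rank_le_4 in auto)

text \<open>A minimal set of a level contains a listed set of the same rank, hence equals
  it.\<close>

lemma card_level_mins: "card (level_mins {a,b,c,d,e,f} rank) \<le> 15"
proof -
  have "A \<in> mins (rank A)" if "A \<in> level_mins {a,b,c,d,e,f} rank" for A
  proof -
    have A: "A \<subseteq> {a,b,c,d,e,f}" "\<And>T. T \<subset> A \<Longrightarrow> rank T \<noteq> rank A"
      using that by (auto simp: level_mins_def)
    obtain T where "T \<in> mins (rank A)" "T \<subseteq> A"
      using ex_mins[OF A(1)] by auto
    then show ?thesis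
      using A(2)[of T] rank_mins[OF rank_le_4[of A], of T] by (cases "T = A") auto
  qed
  then have "level_mins {a,b,c,d,e,f} rank \<subseteq> (\<Union>i\<le>4. mins i)"
    using rank_le_4 by blast
  also have "\<dots> = mins 0 \<union> mins 1 \<union> mins 2 \<union> mins 3 \<union> mins 4"
    using le_4_cases by fastforce
  also have "\<dots> = set [{}, {a}, {c}, {d}, {f}, {a,b}, {a,c}, {b,d}, {c,d}, {e,f},
      {b,d,e}, {a,c,e}, {b,d,f}, {a,c,f}, {a,c,d,f}]"
    unfolding One_nat_def mins_simps by (simp only: list.set Un_insert_left Un_empty_left)
  finally show ?thesis
    by (rule order.trans[OF card_mono[OF finite_set] order.trans[OF card_length]]) simp
qed

lemma card_level_maxs: "card (level_maxs {a,b,c,d,e,f} rank) \<le> 15"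
proof -
  have "B \<in> maxs (rank B)" if "B \<in> level_maxs {a,b,c,d,e,f} rank" for B
  proof -
    have B: "B \<subseteq> {a,b,c,d,e,f}" "\<And>T. B \<subset> T \<Longrightarrow> T \<subseteq> {a,b,c,d,e,f} \<Longrightarrow> rank T \<noteq> rank B"
      using that by (auto simp: level_maxs_def)
    obtain T where "T \<in> maxs (rank B)" "B \<subseteq> T"
      using ex_maxs[OF B(1)] by auto
    then show ?thesis
      using B(2)[of T] rank_maxs[OF rank_le_4[of B], of T] maxs_subset[OF rank_le_4[of B], of T]
      by (cases "T = B") auto
  qed
  then have "level_maxs {a,b,c,d,e,f} rank \<subseteq> (\<Union>i\<le>4. maxs i)"
    using rank_le_4 by blast
  also have "\<dots> = maxs 0 \<union> maxs 1 \<union> maxs 2 \<union> maxs 3 \<union> maxs 4"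
    using le_4_cases by fastforce
  also have "\<dots> = set [{b,e}, {a,d,f}, {b,c,f}, {a,d,e}, {b,c,e},
      {c,d,e,f}, {b,c,e,f}, {a,d,e,f}, {a,b,e,f}, {a,b,c,d},
      {b,c,d,e,f}, {a,b,d,e,f}, {a,b,c,e,f}, {a,b,c,d,e}, {a,b,c,d,e,f}]"
    unfolding One_nat_def maxs_simps by (simp only: list.set Un_insert_left Un_empty_left)
  finally show ?thesis
    by (rule order.trans[OF card_mono[OF finite_set] order.trans[OF card_length]]) simp
qed

end

section \<open>The exponential bound\<close>

lemma gradual_rank_card:
  assumes "finite Y"
  shows "gradual_rank Y (card Y) card"
proof
  show "\<exists>T. T \<subset> S \<and> card S = Suc (card T)" if S: "S \<subseteq> Y" "0 < card S" for S
  proof -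
    obtain x where "x \<in> S" "finite S"
      using S(2) by (auto simp: card_gt_0_iff)
    then show ?thesis
      by (intro exI[of _ "S - {x}"] conjI card.remove) auto
  qed
  show "\<exists>T. S \<subset> T \<and> T \<subseteq> Y \<and> card T = Suc (card S)" if S: "S \<subseteq> Y" "card S < card Y" for S
  proof -
    have "S \<noteq> Y" "finite S"
      using S assms finite_subset by auto
    then obtain x where "x \<in> Y" "x \<notin> S" "finite S"
      using S(1) by blast
    then show ?thesis
      using S(1) by (intro exI[of _ "insert x S"]) auto
  qed
  show "card S \<le> card T" if "S \<subseteq> T" "T \<subseteq> Y" for S T
    using that assms by (meson card_mono finite_subset)
qed (use assms in \<open>auto intro: card_mono\<close>)

text \<open>Each six-point block adds 4 to the top rank at the cost of a factor 15. The
  \<open>r\<close> extra points, ranked by cardinality, reach the top ranks that are not multiples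
  of 4 and contribute at most all \<open>2 ^ r\<close> subsets.\<close>

lemma ex_gradual_rank:
  "\<exists>g. gradual_rank {1..6 * q + r} (4 * q + r) g \<and>
    card (level_mins {1..6 * q + r} g) \<le> 15 ^ q * 2 ^ r \<and>
    card (level_maxs {1..6 * q + r} g) \<le> 15 ^ q * 2 ^ r"
proof (induction q)
  case 0
  have "gradual_rank {1..r} r card"
    using gradual_rank_card[of "{1..r}"] by simp
  moreover have "card (level_mins {1..r} card) \<le> 2 ^ r" "card (level_maxs {1..r} card) \<le> 2 ^ r"
    using card_mono[OF _ level_mins_subset_Pow[of "{1..r}" card]]
      card_mono[OF _ level_maxs_subset_Pow[of "{1..r}" card]] by (simp_all add: card_Pow)
  ultimately show ?case
    by auto
next
  case (Suc q)
  define n where "n = 6 * q + r"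
  obtain g where g: "gradual_rank {1..n} (4 * q + r) g"
    "card (level_mins {1..n} g) \<le> 15 ^ q * 2 ^ r" "card (level_maxs {1..n} g) \<le> 15 ^ q * 2 ^ r"
    using Suc by (auto simp: n_def)
  interpret P: six_points "n + 1" "n + 2" "n + 3" "n + 4" "n + 5" "n + 6"
    by unfold_locales simp
  let ?Z = "{n + 1, n + 2, n + 3, n + 4, n + 5, n + 6}"
  let ?h = "\<lambda>S. g (S \<inter> {1..n}) + P.rank (S \<inter> ?Z)"
  have disj: "{1..n} \<inter> ?Z = {}"
    by auto
  have Y: "{1..n} \<union> ?Z = {1..6 * Suc q + r}"
    by (auto simp: n_def)
  have m: "4 * q + r + 4 = 4 * Suc q + r"
    by simp
  note add = gradual_rank_add[OF g(1) P.gradual_rank disj, unfolded Y m]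
    card_level_mins_add[OF g(1) P.gradual_rank disj, unfolded Y]
    card_level_maxs_add[OF g(1) P.gradual_rank disj, unfolded Y]
  have "card (level_mins {1..6 * Suc q + r} ?h) \<le> 15 ^ q * 2 ^ r * 15"
    using add(2) mult_le_mono[OF g(2) P.card_level_mins] by (rule order.trans)
  moreover have "card (level_maxs {1..6 * Suc q + r} ?h) \<le> 15 ^ q * 2 ^ r * 15"
    using add(3) mult_le_mono[OF g(3) P.card_level_maxs] by (rule order.trans)
  ultimately show ?case
    using add(1) by (intro exI[of _ ?h]) (simp add: mult_ac)
qed

text \<open>\<open>H\<close> consists of all points beyond the ranked ones, so the bound is
  independent of \<open>n\<close>. The factor 2 counts small and large members.\<close>

lemma sat_le:
  assumes "n > 6 * q + r"
  shows "sat n (4 * q + r + 2) \<le> 2 * (15 ^ q * 2 ^ r)"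
proof -
  define Y where "Y = {1..6 * q + r}"
  define H where "H = {6 * q + r + 1..n}"
  obtain g where g: "gradual_rank Y (4 * q + r) g"
    "card (level_mins Y g) \<le> 15 ^ q * 2 ^ r" "card (level_maxs Y g) \<le> 15 ^ q * 2 ^ r"
    unfolding Y_def using ex_gradual_rank by blast
  have H: "H \<inter> Y = {}" "H \<noteq> {}" and YH: "Y \<union> H = {1..n}"
    using assms by (auto simp: Y_def H_def)
  have fin: "finite (level_maxs Y g)"
    by (rule finite_subset[OF level_maxs_subset_Pow]) (simp add: Y_def)
  have "sat n (4 * q + r + 2) \<le> card (level_mins Y g \<union> (\<lambda>B. B \<union> H) ` level_maxs Y g)"
    using gradual_rank.saturated_sperner_system_levels[OF g(1) H] unfolding YH by (rule sat_le_card)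
  also have "\<dots> \<le> card (level_mins Y g) + card (level_maxs Y g)"
    using card_Un_le card_image_le[OF fin] by (meson add_left_mono order.trans)
  finally show ?thesis
    using g(2,3) by linarith
qed

text \<open>Equivalent to \<open>15 ^ 25 \<le> 2 ^ 98\<close>. The exponent is
  \<open>4 * (1 - 1 / 50)\<close>, the allowance for one block of four ranks.\<close>

lemma fifteen_le_powr: "15 \<le> (2::real) powr (98 / 25)"
proof (rule power_le_imp_le_base)
  show "15 ^ Suc 24 \<le> ((2::real) powr (98 / 25)) ^ Suc 24"
    by (simp flip: powr_realpow add: powr_powr del: power_Suc)
qed simp

theorem theorem1p3:
  "\<exists>\<epsilon>::real. \<epsilon> > 0 \<and> (\<forall>k::nat. k \<ge> 1 \<longrightarrow> sat_lim k \<le> 2 powr ((1 - \<epsilon>) * real k))"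
proof (intro exI[of _ "1 / 50"] conjI allI impI)
  fix k :: nat
  assume "k \<ge> 1"
  show "sat_lim k \<le> 2 powr ((1 - 1 / 50) * real k)"
  proof (cases "k = 1")
    case True
    have "sat n k \<le> 1" for n
      using sat_le_card[OF saturated_sperner_system_bot[of "{1..n}"]] True by simp
    then have "sat_lim k \<le> 1"
      using sat_lim_le[of 0 k 1] by simp
    also have "\<dots> \<le> 2 powr ((1 - 1 / 50) * real k)"
      by (rule ge_one_powr_ge_zero) simp_all
    finally show ?thesis .
  next
    case False
    define q r where "q = (k - 2) div 4" and "r = (k - 2) mod 4"
    have k: "k = 4 * q + r + 2" and r: "r < 4"
      using \<open>k \<ge> 1\<close> False by (auto simp: q_def r_def)
    have "sat_lim k \<le> real (2 * (15 ^ q * 2 ^ r))"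
      unfolding k by (rule sat_lim_le[of "Suc (6 * q + r)"]) (rule sat_le, simp)
    also have "\<dots> = 15 ^ q * 2 powr (real r + 1)"
      by (simp add: powr_add powr_realpow)
    \<comment> \<open>The \<open>2\<close> in \<open>k = 4 * q + r + 2\<close> pays for the factor
      2: \<open>r + 1\<close> is at most \<open>49 / 50 * (r + 2)\<close> because
      \<open>r < 4\<close>.\<close>
    also have "\<dots> \<le> (2 powr (98 / 25)) ^ q * 2 powr (49 / 50 * (real r + 2))"
      using r fifteen_le_powr by (intro mult_mono power_mono powr_mono) auto
    also have "\<dots> = 2 powr (real q * (98 / 25) + 49 / 50 * (real r + 2))"
      by (simp add: powr_add powr_power mult.commute)
    also have "real q * (98 / 25) + 49 / 50 * (real r + 2) = (1 - 1 / 50) * real k"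
      by (simp add: k)
    finally show ?thesis .
  qed
qed simp

end
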